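(* Suppose the constant term of $\chi(x,y)$ is nonzero. Then the number $\gamma$ of interior lattice points of the Newton polygon $P$ of $\chi(x,y)$ is given by $$\begin{aligned}\gamma=\ &n_1\mu_1\Big(\frac{n_1m_1-1}{2}\Big)+n_2\mu_2\Big(n_1m_1+\frac{n_2m_2-1}{2}\Big)+n_3\mu_3\Big(n_1m_1+n_2m_2+\frac{n_3m_3-1}{2}\Big)+\cdots\\ &+n_\varepsilon\mu_\varepsilon\Big(n_1m_1+\cdots+n_{\varepsilon-1}m_{\varepsilon-1}+\frac{n_\varepsilon m_\varepsilon-1}{2}\Big)-\frac{n_1(m_1+1)}{2}-\cdots-\frac{n_\varepsilon(m_\varepsilon+1)}{2}+1.\end{aligned}$$
   Context: $\chi(x,y)$ is a polynomial with complex coefficients, monic of degree $n$ in $y$ and irreducible over $\mathbb{C}$. Its Newton polygon $P\subset\mathbb{R}^2$ is the convex hull of the exponent vectors of its nonzero terms. Since the constant term is nonzero, the segment from the origin to $(0,n)$ is an edge of $P$. The first quadrant edges of $P$ are the edges forming the right-hand part of the boundary, from $(0,n)$ down to the right-most point of $P$ on the $x$-axis (i.e. aside from the edges lying on the coordinate axes); they are numbered $1,\dots,\varepsilon$ from top to bottom, the first starting at $(0,n)$ and the $\varepsilon$th ending on the $x$-axis. The outer normal of the $i$th edge is written $(1,\frac{m_i}{\mu_i})$ with $m_i,\mu_i\in\mathbb{Z}$, $\mu_i>0$, $\gcd(m_i,\mu_i)=1$, and $n_i+1$ is the number of lattice points on the $i$th edge. (So the $i$th edge goes from a lattice point $(a,b)$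 to $(a+n_im_i,\,b-n_i\mu_i)$.) *)

theory Defs
  imports "HOL-Analysis.Analysis" "HOL-Computational_Algebra.Computational_Algebra"
begin

text \<open>A polynomial in \<open>x\<close> and \<open>y\<close> is an element of \<open>\<complex>[x][y]\<close>: the coefficient of
  \<open>x\<^sup>i y\<^sup>j\<close> in \<open>p\<close> is \<open>coeff (coeff p j) i\<close>, and \<open>degree p\<close> is the degree in \<open>y\<close>.\<close>

definition exponent_vectors :: "complex poly poly \<Rightarrow> (real \<times> real) set" where
  "exponent_vectors p = {(real i, real j) | i j. coeff (coeff p j) i \<noteq> 0}"

definition newton_polygon :: "complex poly poly \<Rightarrow> (real \<times> real) set" where
  "newton_polygon p = convex hull (exponent_vectors p)"

definition lattice_points :: "(real \<times> real) set" where
  "lattice_points = \<int> \<times> \<int>"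

definition right_boundary :: "(real \<times> real) set \<Rightarrow> (real \<times> real) set" where
  "right_boundary P = {(x, y) \<in> P. \<forall>x'. (x', y) \<in> P \<longrightarrow> x' \<le> x}"

text \<open>No edge on the horizontal axis lies in the right-hand boundary, and the edge on the
  vertical axis does so only if \<open>P\<close> is contained in that axis. In that case (for a monic
  irreducible polynomial: \<open>y - c\<close>) the segment \<open>P\<close> is its own right-hand boundary, and
  counts as a single edge with outer normal \<open>(1, 0)\<close>.\<close>

definition first_quadrant_edges :: "(real \<times> real) set \<Rightarrow> (real \<times> real) set set" where
  "first_quadrant_edges P = {E. E edge_of P \<and> E \<subseteq> right_boundary P}"

definition outer_normal ::
    "(real \<times> real) set \<Rightarrow> (real \<times> real) set \<Rightarrow> real \<times> real \<Rightarrow> bool" where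
  "outer_normal P E w \<longleftrightarrow> w \<noteq> 0 \<and> (\<forall>p\<in>E. \<forall>q\<in>P. w \<bullet> q \<le> w \<bullet> p)"

definition top_to_bottom_numbering ::
    "(real \<times> real) set set \<Rightarrow> nat \<Rightarrow> (nat \<Rightarrow> (real \<times> real) set) \<Rightarrow> bool" where
  "top_to_bottom_numbering \<E> k E \<longleftrightarrow> bij_betw E {1..k} \<E> \<and>
     (\<forall>i\<in>{1..k}. \<forall>j\<in>{1..k}. i < j \<longrightarrow> (\<forall>p\<in>E i. \<forall>q\<in>E j. snd q \<le> snd p))"

end

theory Submission imports Defs begin

text \<open>Let \<open>R y\<close> be the largest abscissa of \<open>P\<close> at height \<open>y\<close>. The lattice points in the interior
  of \<open>P\<close> at an integer height \<open>0 < y < n\<close> are those with \<open>0 < x < R y\<close>, so there are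
  \<open>\<lceil>R y\<rceil> - 1\<close> of them. The right-hand edges are consecutive lattice segments on which \<open>R\<close> is
  affine, and along an edge the pairing \<open>k \<mapsto> N \<mu> - k\<close> evaluates \<open>\<Sum>k. \<lceil>k m / \<mu>\<rceil>\<close>. Summing over the
  edges counts the heights \<open>0, \<dots>, n - 1\<close>; height \<open>0\<close>, which contributes \<open>R 0 - 1 = \<Sum>i. N i * m i - 1\<close>,
  has to be subtracted. If \<open>P\<close> lies on the vertical axis, then \<open>R y = 0\<close> and a height \<open>0 < y < n\<close>
  would contribute \<open>-1\<close> instead of \<open>0\<close>; but then \<open>\<chi>\<close> is an irreducible polynomial in \<open>y\<close> alone, so
  \<open>n = 1\<close> and there is no such height.\<close>

section \<open>Ceiling sums along one edge\<close>

text \<open>The terms at \<open>k\<close> and \<open>N * \<mu> - k\<close> add up to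
  \<open>N * m + 1\<close>, except when \<open>\<mu>\<close> divides \<open>k\<close>: then nothing
  is rounded and the sum is \<open>N * m\<close>. There are \<open>N + 1\<close> such
  \<open>k\<close> from \<open>0\<close> to \<open>N * \<mu>\<close>.\<close>

lemma sum_ceiling_multiples:
  fixes m \<mu> :: int and N :: nat
  assumes "\<mu> > 0" and "coprime m \<mu>"
  shows "2 * (\<Sum>k = 1..int N * \<mu>. \<lceil>real_of_int (k * m) / \<mu>\<rceil>) =
    (int N * \<mu> + 1) * (int N * m) + int N * (\<mu> - 1)"
proof -
  define L where "L = int N * \<mu>"
  define f where "f k = \<lceil>real_of_int (k * m) / \<mu>\<rceil>" for k
  have L0: "0 \<le> L" using assms by (simp add: L_def)
  \<comment> \<open>With \<open>x = k * m / \<mu>\<close> the two terms are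
    \<open>\<lceil>x\<rceil>\<close> and \<open>N * m - \<lfloor>x\<rfloor>\<close>. Ceiling and
    floor differ by 1 unless \<open>x\<close> is an integer, which by coprimality means that
    \<open>\<mu>\<close> divides \<open>k\<close>.\<close>
  have pair: "f k + f (L - k) = int N * m + 1 - (if \<mu> dvd k then 1 else 0)" for k
  proof -
    define x where "x = real_of_int (k * m) / \<mu>"
    have "real_of_int ((L - k) * m) / \<mu> = of_int (int N * m) - x"
      using assms by (simp add: L_def x_def field_simps)
    then have f: "f (L - k) = int N * m - \<lfloor>x\<rfloor>"
      unfolding f_def by linarith
    have "x \<in> \<int> \<longleftrightarrow> \<mu> dvd k * m"
    proof
      assume "x \<in> \<int>"
      then obtain j where "x = of_int j" by (auto elim: Ints_cases)
      then have "real_of_int (k * m) = of_int (\<mu> * j)" using assms(1) by (simp add: x_def field_simps)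
      then show "\<mu> dvd k * m" by (metis of_int_eq_iff dvd_triv_left)
    next
      assume "\<mu> dvd k * m"
      then obtain j where "k * m = \<mu> * j" by (auto simp: dvd_def)
      then have "x = of_int j" using assms(1) by (simp only: x_def) simp
      then show "x \<in> \<int>" by simp
    qed
    also have "\<dots> \<longleftrightarrow> \<mu> dvd k"
      using assms(2) by (simp add: coprime_dvd_mult_left_iff coprime_commute)
    finally have "\<mu> dvd k \<longleftrightarrow> x = of_int \<lfloor>x\<rfloor>"
      by (metis Ints_of_int of_int_floor_cancel floor_of_int Ints_cases)
    moreover have "\<lceil>x\<rceil> = (if x = of_int \<lfloor>x\<rfloor> then \<lfloor>x\<rfloor> else \<lfloor>x\<rfloor> + 1)"
      by (rule ceiling_altdef)
    ultimately show ?thesis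
      unfolding f unfolding f_def x_def[symmetric] by simp
  qed
  have multiples: "{k \<in> {0..L}. \<mu> dvd k} = (\<lambda>j. \<mu> * j) ` {0..int N}"
    using assms(1) by (auto simp: L_def dvd_def image_iff zero_le_mult_iff mult.commute)
  have card: "card {k \<in> {0..L}. \<mu> dvd k} = N + 1"
    unfolding multiples using assms(1) by (subst card_image) (auto simp: inj_on_def)
  have "2 * (\<Sum>k=0..L. f k) = (\<Sum>k=0..L. f k) + (\<Sum>k=0..L. f (L - k))"
    by (subst (3) sum.reindex_bij_witness[of _ "\<lambda>k. L - k" "\<lambda>k. L - k" _ f]) auto
  also have "\<dots> = (\<Sum>k=0..L. int N * m + 1) - (\<Sum>k=0..L. if \<mu> dvd k then 1 else 0)"
    by (simp only: sum.distrib[symmetric] pair sum_subtractf)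
  also have "(\<Sum>k=0..L. if \<mu> dvd k then 1 else 0) = int N + 1"
    using card by (simp add: sum.If_cases Int_def)
  finally have "2 * (\<Sum>k=0..L. f k) = (L + 1) * (int N * m + 1) - (int N + 1)"
    using L0 by simp
  \<comment> \<open>The index \<open>0\<close> was included to make the range symmetric under
    \<open>k \<mapsto> L - k\<close>; its term vanishes.\<close>
  moreover have "(\<Sum>k=0..L. f k) = (\<Sum>k=1..L. f k)"
  proof -
    have "{0..L} = insert 0 {1..L}" using L0 by auto
    then show ?thesis by (simp add: f_def)
  qed
  ultimately show ?thesis
    unfolding L_def[symmetric] f_def[symmetric] by (simp add: L_def algebra_simps)
qed

text \<open>The top row of an edge is excluded, because it is the bottom row of the preceding edge.\<close>

lemma sum_ceiling_edge:
  fixes a b m \<mu> :: int and N :: nat and R :: "real \<Rightarrow> real"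
  assumes "\<mu> > 0" and "coprime m \<mu>"
    and R: "\<And>y. b - int N * \<mu> \<le> y \<Longrightarrow> y \<le> b \<Longrightarrow>
      R (of_int y) = of_int a + of_int (b - y) * of_int m / of_int \<mu>"
  shows "real_of_int (\<Sum>y\<in>{b - int N * \<mu>..<b}. \<lceil>R (of_int y)\<rceil> - 1) =
    real N * \<mu> * (a + (real N * m - 1) / 2) + real N * (m - 1) / 2"
proof -
  \<comment> \<open>The substitution \<open>k = b - y\<close> measures depth below the top of the
    edge, and the integer \<open>a\<close> passes through the ceiling.\<close>
  have "(\<Sum>y\<in>{b - int N * \<mu>..<b}. \<lceil>R (of_int y)\<rceil> - 1) =
      (\<Sum>k = 1..int N * \<mu>. a - 1 + \<lceil>real_of_int (k * m) / \<mu>\<rceil>)"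
  proof (rule sum.reindex_bij_witness[of _ "\<lambda>k. b - k" "\<lambda>y. b - y"], goal_cases)
    case (5 y)
    then have "R (of_int y) = of_int a + real_of_int ((b - y) * m) / \<mu>" using R[of y] by simp
    then show ?case by (simp only: ceiling_add_of_int of_int_add add.commute) (simp add: ceiling_def, linarith)
  qed auto
  also have "\<dots> = int N * \<mu> * (a - 1) + (\<Sum>k = 1..int N * \<mu>. \<lceil>real_of_int (k * m) / \<mu>\<rceil>)"
    using assms(1) by (simp add: sum.distrib)
  finally have "2 * (\<Sum>y\<in>{b - int N * \<mu>..<b}. \<lceil>R (of_int y)\<rceil> - 1) =
      2 * (int N * \<mu> * (a - 1)) + ((int N * \<mu> + 1) * (int N * m) + int N * (\<mu> - 1))"
    using sum_ceiling_multiples[OF assms(1,2), of N] by simp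
  then have "2 * real_of_int (\<Sum>y\<in>{b - int N * \<mu>..<b}. \<lceil>R (of_int y)\<rceil> - 1) =
      real_of_int (2 * (int N * \<mu> * (a - 1)) + ((int N * \<mu> + 1) * (int N * m) + int N * (\<mu> - 1)))"
    by (metis of_int_mult of_int_numeral)
  then show ?thesis by (simp add: field_simps)
qed

text \<open>Since \<open>m\<close> and \<open>\<mu>\<close> are coprime, \<open>(m, -\<mu>)\<close>
  is the primitive step along the segment. The far end is reached after a whole number
  \<open>k\<close> of steps, the segment carries exactly \<open>k + 1\<close> lattice points, and
  hence \<open>k = N\<close>.\<close>

lemma lattice_segment_end:
  fixes a b a' b' m \<mu> :: int and N :: nat
  assumes "\<mu> > 0" and "coprime m \<mu>" and "b' < b" and slope: "(a' - a) * \<mu> = (b - b') * m"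
    and card: "card (closed_segment (real_of_int a, real_of_int b) (real_of_int a', real_of_int b')
                 \<inter> lattice_points) = N + 1"
  shows "a' = a + int N * m" and "b' = b - int N * \<mu>"
proof -
  have "\<mu> dvd (b - b') * m" using slope by (metis dvd_triv_right)
  then have "\<mu> dvd b - b'" using assms(2) by (simp add: coprime_dvd_mult_left_iff coprime_commute)
  then obtain k where k: "b - b' = \<mu> * k" by (auto simp: dvd_def)
  have kpos: "k > 0" using k assms by (metis diff_gt_0_iff_gt zero_less_mult_pos)
  have "(a' - a) * \<mu> = (k * m) * \<mu>" using slope k by (simp add: algebra_simps)
  then have km: "a' - a = k * m" using assms(1) by simp
  have "closed_segment (real_of_int a, real_of_int b) (real_of_int a', real_of_int b') \<inter> lattice_points
      = (\<lambda>s. (real_of_int (a + s * m), real_of_int (b - s * \<mu>))) ` {0..k}" (is "?L = ?R")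
  proof (intro equalityI subsetI)
    fix p assume "p \<in> ?L"
    then obtain t x y where t: "0 \<le> t" "t \<le> 1" and p: "p = (of_int x, of_int y)"
      and x: "of_int x = (1 - t) * of_int a + t * real_of_int a'"
      and y: "of_int y = (1 - t) * of_int b + t * real_of_int b'"
      by (auto simp: closed_segment_def lattice_points_def Ints_def)
    have a': "real_of_int a' = a + k * m" using km by (metis add_diff_cancel_left' diff_add_cancel add.commute of_int_add of_int_mult)
    have b': "real_of_int b' = b - \<mu> * k" using k by (metis diff_diff_eq2 add_diff_cancel_left' of_int_diff of_int_mult)
    have x': "real_of_int (x - a) = t * (k * m)" using x a' by (simp add: algebra_simps)
    have y': "real_of_int (b - y) = t * (k * \<mu>)" using y b' by (simp add: algebra_simps)
    \<comment> \<open>Eliminating the parameter \<open>t\<close> leaves an integer relation, so the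
      divisibility argument used for the far end applies to every lattice point of the
      segment.\<close>
    have "real_of_int ((x - a) * \<mu>) = of_int ((b - y) * m)" unfolding of_int_mult x' y' by simp
    then have eq: "(x - a) * \<mu> = (b - y) * m" using of_int_eq_iff by blast
    then have "\<mu> dvd (b - y) * m" by (metis dvd_triv_right)
    then have "\<mu> dvd b - y" using assms(2) by (simp add: coprime_dvd_mult_left_iff coprime_commute)
    then obtain s where s: "b - y = \<mu> * s" by (auto simp: dvd_def)
    then have "(x - a) * \<mu> = (s * m) * \<mu>" using eq unfolding s by (simp add: mult.commute mult.left_commute)
    then have xs: "x - a = s * m" using assms(1) by simp
    have "real_of_int s = t * k" using y' s assms(1) by simp
    then have "0 \<le> real_of_int s" "real_of_int s \<le> k" using t kpos by (auto simp: mult_le_cancel_right1)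
    then have "s \<in> {0..k}" by simp
    moreover have "x = a + s * m" "y = b - s * \<mu>" using s xs by (auto simp: algebra_simps)
    ultimately show "p \<in> ?R" using p by blast
  next
    fix p assume "p \<in> ?R"
    then obtain s where s: "0 \<le> s" "s \<le> k" and p: "p = (real_of_int (a + s * m), real_of_int (b - s * \<mu>))"
      by auto
    have a': "a' = a + k * m" and b': "b' = b - \<mu> * k" using k km by auto
    have "p = (1 - s / k) *\<^sub>R (real_of_int a, real_of_int b) + (s / k) *\<^sub>R (real_of_int a', real_of_int b')"
      using kpos unfolding p a' b' by (simp add: field_simps)
    moreover have "0 \<le> s / k" "s / k \<le> 1" using s kpos by auto
    ultimately show "p \<in> ?L"
      unfolding closed_segment_def lattice_points_def using p by fastforce
  qed
  then have "card ?L = card {0..k}"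
    by (simp only:) (rule card_image, use assms(1) in \<open>auto simp: inj_on_def\<close>)
  then have "k = int N" using card kpos by simp
  then show "a' = a + int N * m" and "b' = b - int N * \<mu>" using k km by (auto simp: algebra_simps)
qed

section \<open>Convex geometry of the polygon\<close>

text \<open>This abstracts the support of a polynomial that is monic of degree \<open>n\<close> in
  \<open>y\<close> and has a nonzero constant term. Monicity is reflected in
  \<open>below_apex\<close>: only the point \<open>(0, n)\<close> reaches height
  \<open>n\<close>.\<close>

locale lattice_polygon =
  fixes S :: "(real \<times> real) set" and n :: nat
  assumes finite_S: "finite S"
    and lattice: "S \<subseteq> \<nat> \<times> \<nat>"
    and origin: "(0, 0) \<in> S"
    and apex: "(0, real n) \<in> S"
    and below_apex: "(x, y) \<in> S \<Longrightarrow> x = 0 \<and> y = real n \<or> y < real n"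
    and height_pos: "0 < n"
begin

definition P :: "(real \<times> real) set" where
  "P = convex hull S"

text \<open>The rows are nonempty exactly for \<open>0 \<le> y \<le> n\<close>; outside this range
  the value is the unspecified supremum of the empty set.\<close>

definition R :: "real \<Rightarrow> real" where
  "R y = Sup {x. (x, y) \<in> P}"

lemma convex_P: "convex P" and compact_P: "compact P" and polyhedron_P: "polyhedron P"
  using finite_S by (simp_all add: P_def finite_imp_compact_convex_hull polyhedron_convex_hull)

lemma axis_in_P:
  assumes "0 \<le> y" "y \<le> real n" shows "(0, y) \<in> P"
proof -
  have "closed_segment (0, 0) (0, real n) \<subseteq> P"
    unfolding P_def by (intro closed_segment_subset) (auto simp: origin apex hull_inc)
  moreover have "(0, y) = (1 - y / n) *\<^sub>R (0, 0) + (y / n) *\<^sub>R (0, real n)"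
    using height_pos by simp
  then have "(0, y) \<in> closed_segment (0, 0) (0, real n)"
    unfolding in_segment using assms height_pos by (intro exI[of _ "y / n"]) simp
  ultimately show ?thesis by blast
qed

lemma P_subset:
  assumes "(x, y) \<in> P" shows "0 \<le> x" "0 \<le> y" "y \<le> real n" "y = real n \<Longrightarrow> x = 0"
proof -
  \<comment> \<open>\<open>D\<close> bounds all abscissas of \<open>S\<close>. Points other than the
    apex have integer height at most \<open>n - 1\<close>, so all of \<open>S\<close> satisfies
    \<open>x + D * y \<le> D * n\<close>; on \<open>P\<close> this forces \<open>x \<le> 0\<close>
    at height \<open>n\<close>.\<close>
  define D where "D = (\<Sum>p\<in>S. fst p)"
  have nonneg: "0 \<le> fst p \<and> 0 \<le> snd p" if "p \<in> S" for p
    using that lattice by (auto simp: Nats_def)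
  have D: "fst p \<le> D" if "p \<in> S" for p
    unfolding D_def using that nonneg finite_S by (intro member_le_sum) auto
  have D0: "0 \<le> D" using D[OF origin] by simp
  define C where "C = {p :: real \<times> real. (-1, 0) \<bullet> p \<le> 0} \<inter> {p. (0, -1) \<bullet> p \<le> 0} \<inter>
    {p. (1, D) \<bullet> p \<le> D * n} \<inter> {p. (0, 1) \<bullet> p \<le> n}"
  have "S \<subseteq> C"
  proof
    fix p assume p: "p \<in> S"
    obtain i j where [simp]: "p = (i, j)" by force
    from p lattice have "j \<in> \<nat>" by auto
    then obtain j' where [simp]: "j = real j'" by (auto elim: Nats_cases)
    have "i + D * j \<le> D * n" if "j < n"
    proof -
      have "j \<le> real n - 1" using that by simp
      then have "D * j \<le> D * (real n - 1)" using D0 by (rule mult_left_mono)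
      then show ?thesis using D[OF p] by (simp add: algebra_simps)
    qed
    then show "p \<in> C" using below_apex[of i j] nonneg[OF p] p by (auto simp: C_def)
  qed
  moreover have "convex C"
    unfolding C_def by (intro convex_Int convex_halfspace_le)
  ultimately have "P \<subseteq> C" unfolding P_def by (rule hull_minimal)
  then have *: "(x, y) \<in> C" using assms by blast
  then show "0 \<le> x" "0 \<le> y" "y \<le> n" by (auto simp: C_def)
  then show "y = n \<Longrightarrow> x = 0" using * by (auto simp: C_def)
qed

lemma compact_row: "compact {x. (x, y) \<in> P}"
proof -
  have "{x. (x, y) \<in> P} = fst ` (P \<inter> {p. snd p = y})" by force
  moreover have "closed {p :: real \<times> real. snd p = y}"
    by (intro closed_Collect_eq continuous_intros)
  then have "compact (P \<inter> {p. snd p = y})"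
    using compact_P by (rule compact_Int_closed[rotated])
  then have "compact (fst ` (P \<inter> {p. snd p = y}))"
    by (rule compact_continuous_image[rotated]) (intro continuous_intros)
  ultimately show ?thesis by simp
qed

lemma R_upper:
  assumes "(x, y) \<in> P" shows "x \<le> R y"
  unfolding R_def
  by (rule cSup_upper) (use assms compact_row[of y] in \<open>auto intro: bounded_imp_bdd_above compact_imp_bounded\<close>)

lemma R_in_P:
  assumes "0 \<le> y" "y \<le> real n" shows "(R y, y) \<in> P"
proof -
  have "Sup {x. (x, y) \<in> P} \<in> {x. (x, y) \<in> P}"
    using compact_row[of y] axis_in_P[OF assms]
    by (intro closed_contains_Sup) (auto intro: bounded_imp_bdd_above compact_imp_bounded compact_imp_closed)
  then show ?thesis by (simp add: R_def)
qed

lemma right_boundary_eq: "right_boundary P = {(R y, y) | y. 0 \<le> y \<and> y \<le> real n}"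
proof -
  have "(x, y) \<in> right_boundary P \<longleftrightarrow> x = R y \<and> 0 \<le> y \<and> y \<le> real n" for x y
    using P_subset[of x y] R_in_P[of y] R_upper[of _ y]
    by (auto simp: right_boundary_def intro: antisym)
  then show ?thesis by auto
qed

lemma R_top: "R n = 0"
  using R_in_P[of n] P_subset(4) by auto

text \<open>A point of \<open>S\<close> off the vertical axis spans, with the origin and the apex, a
  triangle inside \<open>P\<close>. Rows up to the height of that point meet its side towards the
  origin, higher rows its side towards the apex.\<close>

lemma R_pos:
  assumes "p \<in> S" "0 < fst p" "0 < y" "y < real n"
  shows "0 < R y"
proof -
  obtain i j where p [simp]: "p = (i, j)" by force
  have i: "0 < i" and j: "j < n" "0 \<le> j" using below_apex[of i j] assms lattice by (auto simp: Nats_def)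
  have hull: "s *\<^sub>R p + (1 - s) *\<^sub>R q \<in> P" if "q \<in> S" "0 \<le> s" "s \<le> 1" for q s
    using that assms(1) convex_P by (intro convexD) (auto simp: P_def hull_inc)
  show ?thesis
  proof (cases "y \<le> j")
    case True
    with assms hull[OF origin, of "y / j"] have "(y / j * i, y) \<in> P" by simp
    then have "y / j * i \<le> R y" by (rule R_upper)
    moreover have "0 < y / j * i" using True assms(3) i by simp
    ultimately show ?thesis by linarith
  next
    case False
    define s where "s = (n - y) / (n - j)"
    have s: "0 < s" "s \<le> 1" "s * (n - j) = n - y" using assms j False by (auto simp: s_def field_simps)
    have "s *\<^sub>R p + (1 - s) *\<^sub>R (0, real n) = (s * i, y)" using s(3) by (simp add: algebra_simps)
    then have "(s * i, y) \<in> P" using hull[OF apex, of s] s by simp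
    then have "s * i \<le> R y" by (rule R_upper)
    moreover have "0 < s * i" using s i by simp
    ultimately show ?thesis by linarith
  qed
qed

text \<open>An interior point can be moved slightly in all four axis directions. Conversely, a
  supporting line at a point satisfying the strict inequalities would need a normal vector equal to
  zero.\<close>

lemma interior_P:
  "interior P = {(x, y). 0 < y \<and> y < real n \<and> 0 < x \<and> x < R y}"
proof (intro equalityI subsetI; clarify)
  fix x y assume "(x, y) \<in> interior P"
  then obtain e where e: "e > 0" "cball (x, y) e \<subseteq> P" by (auto simp: mem_interior_cball)
  have near: "(x + u, y + v) \<in> P" if "\<bar>u\<bar> + \<bar>v\<bar> \<le> e" for u v
  proof -
    have "dist (x, y) (x + u, y + v) \<le> \<bar>u\<bar> + \<bar>v\<bar>"
      by (simp add: dist_Pair_Pair dist_real_def sqrt_sum_squares_le_sum_abs)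
    then show ?thesis using that e by (intro subsetD[OF e(2)]) auto
  qed
  show "0 < y \<and> y < real n \<and> 0 < x \<and> x < R y"
    using P_subset(1)[OF near[of "-e" 0]] P_subset(2)[OF near[of 0 "-e"]]
      P_subset(3)[OF near[of 0 e]] R_upper[OF near[of e 0]] e by auto
next
  fix x y assume *: "0 < y" "y < real n" "0 < x" "x < R y"
  have row: "(x', y) \<in> P" if "0 \<le> x'" "x' \<le> R y" for x'
  proof -
    have "(1 - x' / R y) *\<^sub>R (0, y) + (x' / R y) *\<^sub>R (R y, y) \<in> P"
      using * that convex_P R_in_P[of y] axis_in_P[of y] by (intro convexD) auto
    then show ?thesis using * by (simp add: algebra_simps)
  qed
  show "(x, y) \<in> interior P"
  proof (rule ccontr)
    assume "(x, y) \<notin> interior P"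
    obtain w where w: "w \<noteq> 0" "\<And>q. q \<in> P \<Longrightarrow> w \<bullet> (x, y) \<le> w \<bullet> q"
    proof (cases "interior P = {}")
      \<comment> \<open>If \<open>P\<close> has empty interior it lies on a line, whose normal gives
        a functional constant on \<open>P\<close>.\<close>
      case True
      then obtain w c where w: "w \<noteq> 0" and "P \<subseteq> {q. w \<bullet> q = c}"
        using empty_interior_subset_hyperplane[OF convex_P] by blast
      then have "w \<bullet> q = c" if "q \<in> P" for q using that by blast
      with w row[of x] * show thesis by (intro that[of w]) auto
    next
      case False
      then have "(x, y) \<notin> rel_interior P"
        using \<open>(x, y) \<notin> interior P\<close> by (simp add: rel_interior_nonempty_interior)
      with row[of x] * obtain w where "w \<noteq> 0" "\<And>q. q \<in> P \<Longrightarrow> w \<bullet> (x, y) \<le> w \<bullet> q"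
        using supporting_hyperplane_rel_boundary[OF convex_P] by (metis less_imp_le)
      then show thesis by (rule that)
    qed
    obtain w1 w2 where [simp]: "w = (w1, w2)" by force
    \<comment> \<open>The functional attains its minimum strictly inside the row from
      \<open>(0, y)\<close> to \<open>(R y, y)\<close>, so it is constant along rows. Comparison
      with both ends of the vertical axis then shows that it vanishes.\<close>
    have "w1 * x \<le> 0" "w1 * (R y - x) \<ge> 0"
      using w(2)[OF row[of 0]] w(2)[OF row[of "R y"]] * by (auto simp: algebra_simps)
    then have "w1 = 0" using * by (simp add: mult_le_0_iff zero_le_mult_iff)
    have "w2 * y \<le> 0" "w2 * (n - y) \<ge> 0"
      using w(2)[OF axis_in_P[of 0]] w(2)[OF axis_in_P[of n]] * \<open>w1 = 0\<close>
      by (auto simp: algebra_simps)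
    then have "w2 = 0" using * by (simp add: mult_le_0_iff zero_le_mult_iff)
    with \<open>w1 = 0\<close> show False using w(1) by (simp add: zero_prod_def)
  qed
qed

section \<open>Edges on the right-hand boundary\<close>

text \<open>If \<open>P\<close> has nonempty interior, \<open>(R y, y)\<close> is a frontier point
  and hence lies on a facet. The normal of its supporting line has positive first coordinate, which
  makes every point of that facet rightmost in its row.\<close>

lemma edge_covers_right_boundary:
  assumes "0 < y" "y < real n"
  obtains F where "F \<in> first_quadrant_edges P" "(R y, y) \<in> F"
proof (cases "\<exists>p\<in>S. 0 < fst p")
  case True
  then have "0 < R y" using R_pos assms by blast
  then have "(R y / 2, y) \<in> interior P" using assms by (simp add: interior_P)
  then have ne: "interior P \<noteq> {}" by blast
  then have dim: "aff_dim P = 2" using low_dim_interior[of P] by auto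
  have "(R y, y) \<in> rel_frontier P"
    using rel_frontier_nonempty_interior[OF ne] R_in_P[of y] assms
    by (simp add: frontier_def interior_P closure_closed compact_P compact_imp_closed)
  then obtain F where F: "F facet_of P" "(R y, y) \<in> F"
    using rel_frontier_of_polyhedron[OF polyhedron_P] by auto
  have face: "F face_of P" "aff_dim F = 1" using F dim by (auto simp: facet_of_def)
  then have "F exposed_face_of P" using exposed_face_of_polyhedron[OF polyhedron_P] by blast
  moreover have "F \<noteq> {}" "F \<noteq> P" using F dim face by auto
  ultimately obtain w c where w: "w \<noteq> 0" "P \<subseteq> {p. w \<bullet> p \<le> c}" "F = P \<inter> {p. w \<bullet> p = c}"
    unfolding exposed_face_of by metis
  obtain w1 w2 where [simp]: "w = (w1, w2)" by force
  have c: "w1 * R y + w2 * y = c" using F w by auto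
  have le: "w1 * x' + w2 * y' \<le> c" if "(x', y') \<in> P" for x' y' using w that by auto
  have "0 \<le> w1"
  proof -
    have "0 \<le> w1 * R y" using le[OF axis_in_P[of y]] c assms by simp
    then show ?thesis using \<open>0 < R y\<close> by (simp add: zero_le_mult_iff)
  qed
  \<comment> \<open>A functional of the height alone cannot be maximal at a height strictly between
    \<open>0\<close> and \<open>n\<close> unless it is zero.\<close>
  moreover have "w1 \<noteq> 0"
  proof
    assume [simp]: "w1 = 0"
    have "w2 * y \<ge> 0" "w2 * (n - y) \<le> 0"
      using le[OF axis_in_P[of 0]] le[OF axis_in_P[of n]] c by (auto simp: algebra_simps)
    then have "w2 = 0" using assms by (simp add: zero_le_mult_iff mult_le_0_iff)
    then show False using w by (simp add: zero_prod_def)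
  qed
  ultimately have "0 < w1" by simp
  have "F \<subseteq> right_boundary P"
  proof clarify
    fix x' y' assume *: "(x', y') \<in> F"
    then have "x'' \<le> x'" if "(x'', y') \<in> P" for x''
    proof -
      have "w1 * x'' \<le> w1 * x'" using le[OF that] * w(3) by simp
      then show ?thesis using \<open>0 < w1\<close> by simp
    qed
    then show "(x', y') \<in> right_boundary P"
      using * w(3) by (simp add: right_boundary_def)
  qed
  with face F that show thesis by (auto simp: first_quadrant_edges_def edge_of_def)
next
  \<comment> \<open>Here \<open>P\<close> degenerates to a segment on the vertical axis, and the
    edge sought is \<open>P\<close> itself, as a face of itself.\<close>
  case False
  have "S \<subseteq> {p. (1, 0) \<bullet> p = 0}"
  proof
    fix p assume p: "p \<in> S"
    then have "0 \<le> fst p" using lattice by (auto simp: Nats_def)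
    with False p show "p \<in> {p. (1, 0) \<bullet> p = 0}" by (cases p) force
  qed
  then have P0: "P \<subseteq> {p. (1, 0) \<bullet> p = 0}"
    unfolding P_def by (rule hull_minimal) (rule convex_hyperplane)
  have "aff_dim P \<le> 1"
    using aff_dim_subset[OF P0] aff_dim_hyperplane[of "(1, 0) :: real \<times> real" 0] by (simp add: zero_prod_def)
  moreover have "aff_dim P \<noteq> 0"
    using axis_in_P[of 0] axis_in_P[of n] height_pos by (auto simp: aff_dim_eq_0)
  moreover have "aff_dim P \<noteq> -1" using axis_in_P[of 0] by (auto simp flip: aff_dim_empty)
  ultimately have "aff_dim P = 1" using aff_dim_geq[of P] by linarith
  then have "P edge_of P" by (simp add: edge_of_def convex_P face_of_refl)
  moreover have "P \<subseteq> right_boundary P"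
  proof clarify
    fix x y assume xy: "(x, y) \<in> P"
    have "x' \<le> x" if "(x', y) \<in> P" for x' using subsetD[OF P0 that] subsetD[OF P0 xy] by simp
    then show "(x, y) \<in> right_boundary P" using xy by (simp add: right_boundary_def)
  qed
  ultimately show thesis using that R_in_P[of y] assms by (auto simp: first_quadrant_edges_def)
qed

text \<open>A compact convex set of dimension 1 is a segment. Its ends are extreme points of
  \<open>P\<close>, hence belong to \<open>S\<close> and are integral; they differ in height because
  the right-hand boundary has one point per height.\<close>

lemma edge_lattice_segment:
  assumes "F \<in> first_quadrant_edges P"
  obtains a b a' b' :: int where "b' < b"
    "F = closed_segment (real_of_int a, real_of_int b) (real_of_int a', real_of_int b')"
proof -
  have face: "F face_of P" and dim: "aff_dim F = 1" and rb: "F \<subseteq> right_boundary P"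
    using assms by (auto simp: first_quadrant_edges_def edge_of_def)
  have "F \<noteq> {}" using dim aff_dim_empty[of F] by linarith
  moreover have "compact F" "convex F"
    using face compact_P convex_P face_of_imp_compact face_of_imp_convex by blast+
  moreover have "collinear F" using dim by (simp add: collinear_aff_dim)
  ultimately obtain p q where F: "F = closed_segment p q"
    by (rule compact_convex_collinear_segment)
  have ends: "v \<in> S" if "v = p \<or> v = q" for v
  proof -
    have "v extreme_point_of F" using that by (simp add: F extreme_point_of_segment)
    then have "v extreme_point_of P" using extreme_point_of_face[OF face] by simp
    then show ?thesis unfolding P_def by (rule extreme_point_of_convex_hull)
  qed
  have integral: "\<exists>a b :: int. v = (real_of_int a, real_of_int b)" if "v \<in> S" for v
  proof -
    have "fst v \<in> \<int>" "snd v \<in> \<int>" using that lattice Nats_subset_Ints by fastforce+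
    then show ?thesis by (metis Ints_cases prod.collapse)
  qed
  obtain a b :: int where p: "p = (real_of_int a, real_of_int b)" using integral[OF ends[of p]] by blast
  obtain a' b' :: int where q: "q = (real_of_int a', real_of_int b')" using integral[OF ends[of q]] by blast
  have "p \<noteq> q"
  proof
    assume "p = q"
    then have "aff_dim F = 0" by (simp add: F)
    with dim show False by simp
  qed
  moreover have "p \<in> right_boundary P" "q \<in> right_boundary P" using rb F by auto
  ultimately have "b \<noteq> b'" by (auto simp: p q right_boundary_eq)
  then consider "b' < b" | "b < b'" by linarith
  then show thesis
  proof cases
    case 1
    then show thesis using that F p q by blast
  next
    case 2
    have "F = closed_segment q p" by (simp add: F closed_segment_commute)
    with 2 show thesis using that p q by blast
  qed
qed

text \<open>The normal functional is constant on the edge, which fixes the slope and makes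
  \<open>R\<close> affine there; the number of lattice points then fixes the height of the edge as
  \<open>N * \<mu>\<close>.\<close>

lemma edge_with_normal:
  fixes m \<mu> :: int and N :: nat
  assumes F: "F \<in> first_quadrant_edges P" and "\<mu> > 0" "coprime m \<mu>"
    and normal: "outer_normal P F (1, of_int m / of_int \<mu>)"
    and card: "card (F \<inter> lattice_points) = N + 1"
  obtains a b :: int where "0 < N" "snd ` F = {of_int (b - int N * \<mu>)..of_int b}"
    "\<And>y :: real. y \<in> {of_int (b - int N * \<mu>)..of_int b} \<Longrightarrow> R y = a + (b - y) * m / \<mu>"
proof -
  obtain a b a' b' where b: "b' < b"
    and seg: "F = closed_segment (real_of_int a, real_of_int b) (real_of_int a', real_of_int b')"
    using edge_lattice_segment[OF F] .
  have FP: "F \<subseteq> P" and rb: "F \<subseteq> right_boundary P"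
    using F by (auto simp: first_quadrant_edges_def edge_of_imp_subset)
  have ends: "(real_of_int a, real_of_int b) \<in> F" "(real_of_int a', real_of_int b') \<in> F"
    by (auto simp: seg)
  have level: "x + m / \<mu> * y = a + m / \<mu> * b" if "(x, y) \<in> F" for x y
  proof -
    have "(1, m / \<mu>) \<bullet> q \<le> (1, m / \<mu>) \<bullet> p" if "p \<in> F" "q \<in> F" for p q
      using normal that FP by (auto simp: outer_normal_def)
    from this[OF that ends(1)] this[OF ends(1) that] show ?thesis by simp
  qed
  have "real_of_int ((a' - a) * \<mu>) = of_int ((b - b') * m)"
    using level[OF ends(2)] assms(2) by (simp add: field_simps)
  then have slope: "(a' - a) * \<mu> = (b - b') * m" using of_int_eq_iff by blast
  note e = lattice_segment_end[OF assms(2,3) b slope card[unfolded seg]]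
  have N: "0 < N" using e b by (cases N) auto
  have proj: "snd ` F = {of_int (b - int N * \<mu>)..of_int b}"
  proof -
    have "snd ` F = closed_segment (real_of_int b) (real_of_int b')"
      unfolding seg by (subst closed_segment_linear_image[symmetric]) (auto simp: linear_snd)
    also have "\<dots> = {of_int b'..of_int b}" using b by (simp add: closed_segment_eq_real_ivl)
    finally show ?thesis by (simp add: e)
  qed
  have "R y = a + (b - y) * m / \<mu>" if y: "y \<in> {of_int (b - int N * \<mu>)..of_int b}" for y :: real
  proof -
    obtain x where "(x, y) \<in> F" using y unfolding proj[symmetric] by auto
    moreover from this have "x = R y" using rb by (auto simp: right_boundary_eq)
    ultimately show ?thesis using level[of "R y" y] assms(2) by (simp add: field_simps)
  qed
  with N proj that show thesis by blast
qed

section \<open>Counting interior points row by row\<close>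

text \<open>The assumption makes \<open>R\<close> positive on every row in the sum, or leaves no row
  at all. So \<open>\<lceil>R y\<rceil> - 1\<close> is nonnegative and really is the size of a
  row.\<close>

lemma card_interior_lattice_points:
  assumes "(\<exists>p\<in>S. 0 < fst p) \<or> n = 1"
  shows "int (card (interior P \<inter> lattice_points)) = (\<Sum>y\<in>{1..<int n}. \<lceil>R (of_int y)\<rceil> - 1)"
proof -
  let ?f = "\<lambda>(y, x). (real_of_int x, real_of_int y)"
  let ?A = "SIGMA y:{1..<int n}. {1..\<lceil>R (of_int y)\<rceil> - 1}"
  have "interior P \<inter> lattice_points = ?f ` ?A"
  proof (intro equalityI subsetI)
    fix p assume "p \<in> interior P \<inter> lattice_points"
    then obtain x y :: int where p: "p = (real_of_int x, real_of_int y)" "0 < real_of_int y" "real_of_int y < n"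
      "0 < real_of_int x" "real_of_int x < R y"
      by (auto simp: interior_P lattice_points_def elim!: Ints_cases)
    then have "(y, x) \<in> ?A" by (auto simp: less_ceiling_iff)
    then show "p \<in> ?f ` ?A" using p(1) by force
  next
    fix p assume "p \<in> ?f ` ?A"
    then obtain x y :: int where p: "p = (real_of_int x, real_of_int y)" "1 \<le> y" "y < int n" "1 \<le> x" "x < \<lceil>R y\<rceil>" by auto
    then have "real_of_int y < n" by linarith
    with p show "p \<in> interior P \<inter> lattice_points"
      by (simp add: interior_P lattice_points_def less_ceiling_iff)
  qed
  moreover have "inj_on ?f ?A" by (auto simp: inj_on_def)
  ultimately have "card (interior P \<inter> lattice_points) = card ?A" by (simp add: card_image)
  also have "int \<dots> = (\<Sum>y\<in>{1..<int n}. int (nat (\<lceil>R (of_int y)\<rceil> - 1)))"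
    by (subst card_SigmaI) auto
  also have "\<dots> = (\<Sum>y\<in>{1..<int n}. \<lceil>R (of_int y)\<rceil> - 1)"
  proof (rule sum.cong)
    fix y assume y: "y \<in> {1..<int n}"
    then have "real_of_int y < n" by auto
    then have "0 < R (of_int y)" using R_pos y assms by auto
    then show "int (nat (\<lceil>R (of_int y)\<rceil> - 1)) = \<lceil>R (of_int y)\<rceil> - 1" by simp
  qed simp
  finally show ?thesis .
qed

end

section \<open>Intervals stacked without gaps\<close>

text \<open>Both sequences of endpoints decrease. A gap at the top, at the bottom or between
  neighbours would therefore have a midpoint that no interval covers.\<close>

lemma consecutive_intervals:
  fixes l u :: "nat \<Rightarrow> real" and k :: nat
  assumes k: "0 < h"
    and nonempty: "\<And>i. i \<in> {1..k} \<Longrightarrow> l i < u i"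
    and within: "\<And>i. i \<in> {1..k} \<Longrightarrow> 0 \<le> l i \<and> u i \<le> h"
    and ordered: "\<And>i j. i \<in> {1..k} \<Longrightarrow> j \<in> {1..k} \<Longrightarrow> i < j \<Longrightarrow> u j \<le> l i"
    and cover: "\<And>y. 0 < y \<Longrightarrow> y < h \<Longrightarrow> \<exists>i\<in>{1..k}. l i \<le> y \<and> y \<le> u i"
  shows "1 \<le> k" and "u 1 = h" and "l k = 0"
    and "\<And>i. 1 \<le> i \<Longrightarrow> i < k \<Longrightarrow> u (Suc i) = l i"
proof -
  show k1: "1 \<le> k" using cover[of "h / 2"] k by auto
  have lu: "u j \<le> u i" if "i \<in> {1..k}" "j \<in> {1..k}" "i \<le> j" for i j
    using ordered[OF that(1,2)] nonempty[OF that(1)] that(3) by (cases "i = j") auto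
  have ll: "l j \<le> l i" if "i \<in> {1..k}" "j \<in> {1..k}" "i \<le> j" for i j
    using ordered[OF that(1,2)] nonempty[OF that(2)] that(3) by (cases "i = j") auto
  show "u 1 = h"
  proof (rule ccontr)
    assume "u 1 \<noteq> h"
    then have "u 1 < h" "0 < u 1" using within[of 1] nonempty[of 1] k1 by auto
    then obtain i where "i \<in> {1..k}" "(u 1 + h) / 2 \<le> u i" using cover[of "(u 1 + h) / 2"] by auto
    with lu[of 1 i] k1 \<open>u 1 < h\<close> show False by auto
  qed
  show "l k = 0"
  proof (rule ccontr)
    assume "l k \<noteq> 0"
    then have "0 < l k" "l k < h" using within[of k] nonempty[of k] k1 by auto
    then obtain i where "i \<in> {1..k}" "l i \<le> l k / 2" using cover[of "l k / 2"] by auto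
    with ll[of i k] k1 \<open>0 < l k\<close> show False by auto
  qed
  show "u (Suc i) = l i" if i: "1 \<le> i" "i < k" for i
  proof (rule ccontr)
    assume "u (Suc i) \<noteq> l i"
    then have lt: "u (Suc i) < l i" using ordered[of i "Suc i"] i by auto
    \<comment> \<open>Intervals up to index \<open>i\<close> lie above this midpoint and all later
      ones below it.\<close>
    define y where "y = (u (Suc i) + l i) / 2"
    have y: "u (Suc i) < y" "y < l i" using lt by (auto simp: y_def)
    moreover have "0 < y" "y < h"
      using y within[of i] within[of "Suc i"] nonempty[of i] nonempty[of "Suc i"] i by auto
    ultimately obtain j where j: "j \<in> {1..k}" "l j \<le> y" "y \<le> u j" using cover[of y] by auto
    show False
    proof (cases "j \<le> i")
      case True
      then show False using ll[of j i] i j y by auto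
    next
      case False
      then show False using lu[of "Suc i" j] i j y by auto
    qed
  qed
qed

section \<open>Summation over the edges\<close>

context lattice_polygon
begin

lemma card_interior_by_edges:
  fixes \<epsilon> :: nat and E :: "nat \<Rightarrow> (real \<times> real) set" and m \<mu> :: "nat \<Rightarrow> int" and N :: "nat \<Rightarrow> nat"
  assumes width: "(\<exists>p\<in>S. 0 < fst p) \<or> n = 1"
    and numbering: "top_to_bottom_numbering (first_quadrant_edges P) \<epsilon> E"
    and \<mu>: "\<And>i. i \<in> {1..\<epsilon>} \<Longrightarrow> \<mu> i > 0"
    and coprime: "\<And>i. i \<in> {1..\<epsilon>} \<Longrightarrow> coprime (m i) (\<mu> i)"
    and normal: "\<And>i. i \<in> {1..\<epsilon>} \<Longrightarrow> outer_normal P (E i) (1, of_int (m i) / of_int (\<mu> i))"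
    and card: "\<And>i. i \<in> {1..\<epsilon>} \<Longrightarrow> card (E i \<inter> lattice_points) = N i + 1"
  shows "real (card (interior P \<inter> lattice_points)) =
      (\<Sum>i=1..\<epsilon>. real (N i) * of_int (\<mu> i) *
         ((\<Sum>j=1..<i. real (N j) * of_int (m j)) + (real (N i) * of_int (m i) - 1) / 2))
      - (\<Sum>i=1..\<epsilon>. real (N i) * (of_int (m i) + 1) / 2) + 1"
proof -
  have bij: "bij_betw E {1..\<epsilon>} (first_quadrant_edges P)"
    and order: "\<And>i j p q. i \<in> {1..\<epsilon>} \<Longrightarrow> j \<in> {1..\<epsilon>} \<Longrightarrow> i < j \<Longrightarrow> p \<in> E i \<Longrightarrow> q \<in> E j \<Longrightarrow> snd q \<le> snd p"
    using numbering unfolding top_to_bottom_numbering_def by blast+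
  have E: "E i \<in> first_quadrant_edges P" if "i \<in> {1..\<epsilon>}" for i
    using bij that by (rule bij_betwE[THEN bspec])
  \<comment> \<open>Bundling the data of one edge into a predicate lets its integers
    \<open>a\<close> and \<open>b\<close> be chosen as functions of the index.\<close>
  define Q where "Q i a b \<longleftrightarrow> 0 < N i \<and>
      snd ` E i = {real_of_int (b - int (N i) * \<mu> i)..real_of_int b} \<and>
      (\<forall>y \<in> {real_of_int (b - int (N i) * \<mu> i)..real_of_int b}.
        R y = real_of_int a + (of_int b - y) * of_int (m i) / of_int (\<mu> i))" for i and a b :: int
  have "\<exists>a b. Q i a b" if i: "i \<in> {1..\<epsilon>}" for i
  proof -
    obtain a b :: int where "0 < N i"
      "snd ` E i = {real_of_int (b - int (N i) * \<mu> i)..real_of_int b}"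
      "\<And>y. y \<in> {real_of_int (b - int (N i) * \<mu> i)..real_of_int b} \<Longrightarrow>
        R y = real_of_int a + (of_int b - y) * of_int (m i) / of_int (\<mu> i)"
      by (rule edge_with_normal[OF E[OF i] \<mu>[OF i] coprime[OF i] normal[OF i] card[OF i]]) (rule that)
    then have "Q i a b" unfolding Q_def by blast
    then show ?thesis by blast
  qed
  then obtain a b :: "nat \<Rightarrow> int" where "\<And>i. i \<in> {1..\<epsilon>} \<Longrightarrow> Q i (a i) (b i)" by metis
  note ab = this[unfolded Q_def]
  define c where "c i = b i - int (N i) * \<mu> i" for i
  have c_less: "c i < b i" if "i \<in> {1..\<epsilon>}" for i
    using ab[OF that] \<mu>[OF that] by (simp add: c_def)
  have proj: "snd ` E i = {real_of_int (c i)..real_of_int (b i)}" if "i \<in> {1..\<epsilon>}" for i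
    using ab[OF that] by (simp add: c_def)
  have R_edge: "R y = a i + (b i - y) * m i / \<mu> i"
    if "i \<in> {1..\<epsilon>}" "real_of_int (c i) \<le> y" "y \<le> b i" for i and y :: real
    using ab[OF that(1)] that(2,3) by (simp add: c_def)
  have on_edge: "\<exists>x. (x, y) \<in> E i"
    if i: "i \<in> {1..\<epsilon>}" and y: "real_of_int (c i) \<le> y" "y \<le> b i" for i and y :: real
  proof -
    have "y \<in> snd ` E i" unfolding proj[OF i] using y by simp
    then show ?thesis by auto
  qed
  have ends: "\<exists>x. (x, real_of_int (c i)) \<in> E i" "\<exists>x. (x, real_of_int (b i)) \<in> E i"
    if i: "i \<in> {1..\<epsilon>}" for i
    using on_edge[OF i] c_less[OF i] by auto
  have within: "0 \<le> real_of_int (c i) \<and> real_of_int (b i) \<le> real n" if i: "i \<in> {1..\<epsilon>}" for i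
  proof -
    have "E i \<subseteq> P" using E[OF i] by (auto simp: first_quadrant_edges_def dest: edge_of_imp_subset)
    then show ?thesis using ends[OF i] P_subset(2,3) by blast
  qed
  have ordered: "real_of_int (b j) \<le> real_of_int (c i)"
    if ij: "i \<in> {1..\<epsilon>}" "j \<in> {1..\<epsilon>}" "i < j" for i j
  proof -
    obtain x x' where "(x, real_of_int (c i)) \<in> E i" "(x', real_of_int (b j)) \<in> E j"
      using ends(1)[OF ij(1)] ends(2)[OF ij(2)] by blast
    from order[OF ij this] show ?thesis by simp
  qed
  have cover: "\<exists>i\<in>{1..\<epsilon>}. real_of_int (c i) \<le> y \<and> y \<le> real_of_int (b i)" if y: "0 < y" "y < real n" for y
  proof -
    obtain F where "F \<in> first_quadrant_edges P" "(R y, y) \<in> F"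
      using edge_covers_right_boundary[OF y] .
    then obtain i where i: "i \<in> {1..\<epsilon>}" and "(R y, y) \<in> E i"
      using bij unfolding bij_betw_def by blast
    then have "y \<in> snd ` E i" by force
    then show ?thesis using proj[OF i] i by auto
  qed
  have n: "0 < real n" using height_pos by simp
  have c_less': "real_of_int (c i) < real_of_int (b i)" if "i \<in> {1..\<epsilon>}" for i
    using c_less[OF that] by simp
  note chain = consecutive_intervals[where h = "real n" and k = \<epsilon> and
      l = "\<lambda>i. real_of_int (c i)" and u = "\<lambda>i. real_of_int (b i)"]
  note chain_facts = n c_less' within ordered cover
  have \<epsilon>: "1 \<le> \<epsilon>" by (rule chain(1); fact chain_facts)
  have "real_of_int (b 1) = real n" by (rule chain(2); fact chain_facts)
  then have top: "b 1 = int n" by linarith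
  have "real_of_int (c \<epsilon>) = 0" by (rule chain(3); fact chain_facts)
  then have bottom: "c \<epsilon> = 0" by simp
  have step: "b (Suc i) = c i" if i: "1 \<le> i" "i < \<epsilon>" for i
  proof -
    have "real_of_int (b (Suc i)) = real_of_int (c i)" by (rule chain(4); fact chain_facts i)
    then show ?thesis by simp
  qed
  have end_value: "R (of_int (c i)) = of_int (a i) + real (N i) * of_int (m i)" if i: "i \<in> {1..\<epsilon>}" for i
    using R_edge[OF i, of "c i"] c_less[OF i] \<mu>[OF i] by (simp add: c_def)
  have start_value: "R (of_int (b i)) = of_int (a i)" if i: "i \<in> {1..\<epsilon>}" for i
    using R_edge[OF i, of "b i"] c_less[OF i] by simp
  \<comment> \<open>The abscissas accumulate downwards from \<open>R n = 0\<close>: each edge starts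
    where the preceding one ends, \<open>N j * m j\<close> further to the right.\<close>
  have a: "real_of_int (a i) = (\<Sum>j=1..<i. real (N j) * of_int (m j))" if "1 \<le> i" "i \<le> \<epsilon>" for i
    using that
  proof (induction i rule: nat_induct_at_least)
    case base
    then show ?case using start_value[of 1] R_top top by simp
  next
    case (Suc i)
    then have "real_of_int (a (Suc i)) = of_int (a i) + real (N i) * of_int (m i)"
      using start_value[of "Suc i"] step[of i] end_value[of i] by simp
    with Suc show ?case by simp
  qed
  define g where "g i = real (N i) * \<mu> i * (a i + (real (N i) * m i - 1) / 2) + real (N i) * (m i - 1) / 2" for i
  have edge_rows: "real_of_int (\<Sum>y\<in>{c i..<b i}. \<lceil>R (of_int y)\<rceil> - 1) = g i" if i: "i \<in> {1..\<epsilon>}" for i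
  proof -
    have "R (of_int y) = of_int (a i) + of_int (b i - y) * of_int (m i) / of_int (\<mu> i)"
      if "b i - int (N i) * \<mu> i \<le> y" "y \<le> b i" for y
      using R_edge[OF i, of "of_int y"] that by (simp add: c_def del: of_int_mult of_int_diff flip: of_int_diff)
    from sum_ceiling_edge[OF \<mu>[OF i] coprime[OF i] this] show ?thesis
      by (simp only: g_def c_def)
  qed
  \<comment> \<open>The first \<open>k\<close> edges account for the rows from \<open>c k\<close> up
    to \<open>n - 1\<close>. At \<open>k = \<epsilon>\<close> these are all rows from height
    \<open>0\<close>.\<close>
  have rows: "real_of_int (\<Sum>y\<in>{c k..<int n}. \<lceil>R (of_int y)\<rceil> - 1) = (\<Sum>i=1..k. g i) \<and> c k < int n"
    if "1 \<le> k" "k \<le> \<epsilon>" for k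
    using that
  proof (induction k rule: nat_induct_at_least)
    case base
    then show ?case using edge_rows[of 1] top c_less[of 1] by simp
  next
    case (Suc k)
    then have lt: "c (Suc k) < c k" "c k < int n" and b: "b (Suc k) = c k"
      using c_less[of "Suc k"] step[of k] by auto
    have "{c (Suc k)..<int n} = {c (Suc k)..<b (Suc k)} \<union> {c k..<int n}" using lt b by auto
    then have "(\<Sum>y\<in>{c (Suc k)..<int n}. \<lceil>R (of_int y)\<rceil> - 1) =
        (\<Sum>y\<in>{c (Suc k)..<b (Suc k)}. \<lceil>R (of_int y)\<rceil> - 1) + (\<Sum>y\<in>{c k..<int n}. \<lceil>R (of_int y)\<rceil> - 1)"
      by (simp only:) (rule sum.union_disjoint, use b in auto)
    then have "real_of_int (\<Sum>y\<in>{c (Suc k)..<int n}. \<lceil>R (of_int y)\<rceil> - 1) = g (Suc k) + (\<Sum>i=1..k. g i)"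
      using edge_rows[of "Suc k"] Suc by simp
    then show ?case using lt by simp
  qed
  have R0: "R 0 = (\<Sum>i=1..\<epsilon>. real (N i) * of_int (m i))"
  proof -
    have "{1..\<epsilon>} = insert \<epsilon> {1..<\<epsilon>}" using \<epsilon> by auto
    then show ?thesis using end_value[of \<epsilon>] bottom a[of \<epsilon>] \<epsilon> by simp
  qed
  also have "\<dots> = real_of_int (\<Sum>i=1..\<epsilon>. int (N i) * m i)" by simp
  \<comment> \<open>\<open>R 0\<close> is an integer, so the extra row at height \<open>0\<close>
    contributes exactly \<open>R 0 - 1\<close>.\<close>
  finally have ceil0: "real_of_int \<lceil>R 0\<rceil> = R 0" by (metis ceiling_of_int)
  have "{0..<int n} = insert 0 {1..<int n}" using height_pos by auto
  then have "(\<Sum>y\<in>{0..<int n}. \<lceil>R (of_int y)\<rceil> - 1) =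
      \<lceil>R 0\<rceil> - 1 + int (card (interior P \<inter> lattice_points))"
    using card_interior_lattice_points[OF width] by simp
  then have "real (card (interior P \<inter> lattice_points)) = (\<Sum>i=1..\<epsilon>. g i) - R 0 + 1"
    using rows[of \<epsilon>] \<epsilon> bottom ceil0 by simp
  \<comment> \<open>Distributing \<open>R 0\<close> over the edges turns each
    \<open>N i * (m i - 1) / 2\<close> into \<open>- N i * (m i + 1) / 2\<close>.\<close>
  also have "\<dots> = (\<Sum>i=1..\<epsilon>. g i - real (N i) * of_int (m i)) + 1"
    by (simp add: R0 sum_subtractf)
  also have "(\<Sum>i=1..\<epsilon>. g i - real (N i) * of_int (m i)) =
      (\<Sum>i=1..\<epsilon>. real (N i) * of_int (\<mu> i) *
         ((\<Sum>j=1..<i. real (N j) * of_int (m j)) + (real (N i) * of_int (m i) - 1) / 2)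
        - real (N i) * (of_int (m i) + 1) / 2)"
    by (rule sum.cong) (auto simp: g_def a field_simps)
  finally show ?thesis by (simp add: sum_subtractf)
qed

end

section \<open>From the polynomial to its polygon\<close>

text \<open>Such a \<open>p\<close> is a polynomial in \<open>y\<close> alone. In degree at least 2
  it has a complex root \<open>z\<close>, and by irreducibility the cofactor of \<open>y - z\<close>
  is a unit, so the degree is 1 after all.\<close>

lemma constant_coeffs_irreducible_degree:
  fixes p :: "complex poly poly"
  assumes "irreducible p" and const: "\<And>j. degree (coeff p j) = 0"
  shows "degree p \<le> 1"
proof (rule ccontr)
  assume deg: "\<not> degree p \<le> 1"
  define q where "q = map_poly (\<lambda>c. coeff c 0) p"
  have c: "coeff p j = [:coeff q j:]" for j
    using degree_0_id[OF const[of j]] by (simp add: q_def coeff_map_poly)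
  have dq: "degree q = degree p"
    by (rule order.antisym; intro degree_le allI impI) (use c coeff_eq_0 in force)+
  have ev: "poly p [:z:] = [:poly q z:]" for z
  proof -
    have "poly p [:z:] = (\<Sum>i\<le>degree p. [:coeff q i * z ^ i:])"
      unfolding poly_altdef c poly_const_pow by (simp add: mult.commute)
    then show ?thesis by (simp only: sum_to_poly poly_altdef dq)
  qed
  obtain z where "poly q z = 0"
    using deg dq fundamental_theorem_of_algebra_alt[of q] by fastforce
  then have "[:-[:z:], 1:] dvd p"
    by (subst poly_eq_0_iff_dvd[symmetric]) (simp add: ev)
  then obtain r where r: "p = [:-[:z:], 1:] * r" by (auto simp: dvd_def)
  have "\<not> [:-[:z:], 1:] dvd 1" by (auto simp: is_unit_poly_iff)
  with irreducibleD[OF assms(1) r] have "r dvd 1" by blast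
  then have "degree r = 0" by (auto simp: is_unit_poly_iff)
  then have "degree p \<le> 1" using r degree_mult_le[of "[:-[:z:], 1:]" r] by simp
  with deg show False by simp
qed

theorem theorem5p6:
  fixes chi :: "complex poly poly"
    and n \<epsilon> \<gamma> :: nat
    and P :: "(real \<times> real) set"
    and E :: "nat \<Rightarrow> (real \<times> real) set"
    and m \<mu> :: "nat \<Rightarrow> int"
    and N :: "nat \<Rightarrow> nat"
  assumes "degree chi = n" and "lead_coeff chi = 1"
    and "irreducible chi"
    and "coeff (coeff chi 0) 0 \<noteq> 0"
    and "P = newton_polygon chi"
    and "top_to_bottom_numbering (first_quadrant_edges P) \<epsilon> E"
    and "\<And>i. i \<in> {1..\<epsilon>} \<Longrightarrow> \<mu> i > 0"
    and "\<And>i. i \<in> {1..\<epsilon>} \<Longrightarrow> coprime (m i) (\<mu> i)"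
    and "\<And>i. i \<in> {1..\<epsilon>} \<Longrightarrow> outer_normal P (E i) (1, of_int (m i) / of_int (\<mu> i))"
    and "\<And>i. i \<in> {1..\<epsilon>} \<Longrightarrow> card (E i \<inter> lattice_points) = N i + 1"
    and "\<gamma> = card (interior P \<inter> lattice_points)"
  shows "real \<gamma> =
      (\<Sum>i=1..\<epsilon>. real (N i) * of_int (\<mu> i) *
         ((\<Sum>j=1..<i. real (N j) * of_int (m j)) + (real (N i) * of_int (m i) - 1) / 2))
      - (\<Sum>i=1..\<epsilon>. real (N i) * (of_int (m i) + 1) / 2) + 1"
proof -
  let ?S = "exponent_vectors chi"
  have lead: "coeff chi n = 1" using assms(1,2) by simp
  \<comment> \<open>A monic polynomial of degree 0 is 1, a unit and so not irreducible.\<close>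
  have "0 < n"
  proof (rule ccontr)
    assume "\<not> 0 < n"
    then have "chi = 1" using assms(1) lead degree_0_id[of chi] by (simp add: one_pCons)
    then show False using assms(3) by (simp add: irreducible_def)
  qed
  have "lattice_polygon ?S n"
  proof
    have "?S \<subseteq> (\<lambda>(j, i). (real i, real j)) ` (SIGMA j:{..n}. {..degree (coeff chi j)})"
      using assms(1) by (force simp: exponent_vectors_def intro: le_degree)
    then show "finite ?S" by (rule finite_subset) auto
    show "x = 0 \<and> y = real n \<or> y < real n" if xy: "(x, y) \<in> ?S" for x y
    proof -
      obtain i j where [simp]: "x = real i" "y = real j" and ij: "coeff (coeff chi j) i \<noteq> 0"
        using xy by (auto simp: exponent_vectors_def)
      have "j \<le> n" using ij assms(1) by (metis coeff_0 le_degree)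
      \<comment> \<open>The coefficient of \<open>y ^ n\<close> is the constant 1, so no monomial at
        height \<open>n\<close> contains \<open>x\<close>.\<close>
      moreover have "i = 0" if "j = n" using ij lead that by (cases i) auto
      ultimately show ?thesis by fastforce
    qed
    show "(0, real n) \<in> ?S" using lead by (force simp: exponent_vectors_def)
    show "(0, 0) \<in> ?S" using assms(4) by (force simp: exponent_vectors_def)
  qed (use \<open>0 < n\<close> in \<open>auto simp: exponent_vectors_def\<close>)
  then interpret lattice_polygon ?S n .
  have P: "P = lattice_polygon.P ?S"
    by (simp add: assms(5) newton_polygon_def P_def)
  \<comment> \<open>Irreducibility enters here: if \<open>x\<close> does not occur in
    \<open>chi\<close>, then the degree is 1.\<close>
  have "(\<exists>p\<in>?S. 0 < fst p) \<or> n = 1"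
  proof (cases "\<exists>j i. coeff (coeff chi j) i \<noteq> 0 \<and> 0 < i")
    case True
    then show ?thesis by (fastforce simp: exponent_vectors_def)
  next
    case False
    then have "degree (coeff chi j) = 0" for j
      by (metis coeff_0 degree_0 leading_coeff_neq_0 neq0_conv)
    then show ?thesis using constant_coeffs_irreducible_degree[OF assms(3)] \<open>0 < n\<close> assms(1) by simp
  qed
  then show ?thesis
    unfolding assms(11) P
    by (rule card_interior_by_edges) (use assms(6-10) in \<open>simp_all add: P\<close>)
qed

end
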